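(* Consider a John elastic material with rigidity parameter $k>0$ whose underlying fluid $(\hat\rho_0,\hat p_0)$ satisfies: \begin{itemize} \item[(F1)] $\hat\rho_0\in C^1([0,\infty))$, $\hat\rho_0(n)\ge 0$ with equality if and only if $n=0$, and $\hat\rho_0(n)/n^{2/3}$ is bounded as $n\to 0$; \item[(F2)] $\hat p_0\in C^1([0,\infty))$, $\hat p_0(n)\ge 0$, $\hat p_0'(n)\ge 0$, with equalities if and only if $n=0$, and $\hat p_0(n)/n^{2/3}$ is bounded as $n\to 0$; \item[(F3)] $\hat p_0(n)\le\hat\rho_0(n)$ for all $n\ge 0$. \end{itemize} Let $(x,y,m)$ be a regular ball solution with radius $R>0$, and let $\rho(r)=\hat\rho(x(r),y(r))$, $p_{\mathrm{rad}}(r)=\hat p_{\mathrm{rad}}(x(r),y(r))$, $p_{\mathrm{tan}}(r)=\hat p_{\mathrm{tan}}(x(r),y(r))$, and $\rho_0(r)=\hat\rho_0(n(r))$, $p_0(r)=\hat p_0(n(r))$ with $n(r)=y(r)\sqrt{x(r)}$. Then: \begin{itemize} \item[(i)] The dominant energy condition is satisfied in the radial direction, and $$0<\frac{p_{\mathrm{rad}}(r)}{\rho(r)}<\frac{p_0(r)}{\rho_0(r)}\quad\text{for all } r\in(0,R).$$ \item[(ii)] Let $k<1$ and $\beta=\max(k,1/3)$. If $\hat p_0(n)\le(1-\beta)\hat\rho_0(n)$ for all $n\ge 0$, then the dominant energy condition is satisfied in the tangential direction, and $$0<\frac{p_{\mathrm{tan}}(r)}{\rho(r)}<\frac{p_0(r)}{\rho_0(r)}+\beta\quad\text{for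 all } r\in(0,R).$$ \item[(iii)] If $$\lim_{r\to R^-}\frac{3p_0(r)}{2\rho_0(r)}>1,$$ then the dominant energy condition in the tangential direction is violated in an interior neighborhood of the boundary, i.e., there exists $\varepsilon>0$ such that $p_{\mathrm{tan}}(r)>\rho(r)$ for $r\in(R-\varepsilon,R]$. \end{itemize}
   Context: John elastic material. Given $k\ge 0$ (the rigidity parameter) and a function $\hat\rho_0$ of $n\ge 0$, let $\hat p_0(n)=n^2\frac{d}{dn}\big(\hat\rho_0(n)/n\big)$; the pair $(\hat\rho_0,\hat p_0)$ is called the underlying fluid. With $n=y\sqrt{x}$ and $x,y\geq 0$, set $$\hat\rho(x,y)=\hat\rho_0(n)\Big[1+k\Big(\frac{x+2y}{n^{2/3}}-3\Big)\Big],$$ $$\hat p_{\mathrm{rad}}(x,y)=\hat p_0(n)\Big[1+k\Big(\frac{x+2y}{n^{2/3}}-3\Big)\Big]+\hat\rho_0(n)\frac{4k(x-y)}{3n^{2/3}},$$ $$\hat p_{\mathrm{tan}}(x,y)=\hat p_0(n)\Big[1+k\Big(\frac{x+2y}{n^{2/3}}-3\Big)\Big]-\hat\rho_0(n)\frac{2k(x-y)}{3n^{2/3}},$$ these functions being equal to $0$ when $x=0$ or $y=0$. The dominant energy condition in the radial (resp. tangential) direction is the inequality $|p_{\mathrm{rad}}(r)|\le\rho(r)$ (resp. $|p_{\mathrm{tan}}(r)|\le\rho(r)$) in the body. The system. For radial functions $x(r),y(r),m(r)$ (prime denotes $d/dr$; $\hat\rho,\hat p_{\mathrm{rad}},\hat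 p_{\mathrm{tan}}$ and their partial derivatives are evaluated at $(x(r),y(r))$): $$x'=\frac{1}{\partial_x\hat p_{\mathrm{rad}}}\Big[-(\hat p_{\mathrm{rad}}+\hat\rho)\frac{m+r^3\hat p_{\mathrm{rad}}/2}{r(r-2m)}+\frac{2}{r}(\hat p_{\mathrm{tan}}-\hat p_{\mathrm{rad}})-y'\,\partial_y\hat p_{\mathrm{rad}}\Big],$$ $$y'=\frac{2}{r}\Big(\sqrt{\frac{r}{r-2m}\,xy}-y\Big),\qquad m'=\frac12 r^2\hat\rho.$$ Regular ball solution. A triple $(x,y,m)$ of radial functions is called a regular ball solution of this system with radius $R>0$ and ADM mass $M>0$ if: (i) $x,y,m\in C^1([0,R])$ (meaning $C^1$ on $(0,R)$, with the functions and their derivatives extending continuously to the boundary); (ii) $x(0)=y(0)=:h>0$ and $m(0)=0$; (iii) $x,y>0$ for $r\in[0,R)$, and $0<2m(r)<r$ for all $r>0$; (iv) for $r>R$, $x=y=0$ and $m=m(R)=:M$; (v) $p_{\mathrm{rad}}(r):=\hat p_{\mathrm{rad}}(x(r),y(r))$ satisfies $p_{\mathrm{rad}}(r)>0$ for $r\in[0,R)$ and $p_{\mathrm{rad}}(R)=0$; (vi) $(x,y,m)$ solves the system for $r\in(0,R)$. *)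

theory Defs
  imports "HOL-Analysis.Analysis"
begin

text \<open>\<open>f\<close> is continuously differentiable in the interior of the interval \<open>S\<close>, and \<open>f\<close> and its
  derivative extend continuously to the end points of \<open>S\<close>; the values of \<open>f'\<close> on \<open>S\<close>,
  end points included, are thereby determined by \<open>f\<close>.\<close>

definition has_C1_deriv_on :: "(real \<Rightarrow> real) \<Rightarrow> (real \<Rightarrow> real) \<Rightarrow> real set \<Rightarrow> bool" where
  "has_C1_deriv_on f f' S \<longleftrightarrow>
     continuous_on S f \<and> continuous_on S f' \<and>
     (\<forall>t\<in>interior S. (f has_real_derivative f' t) (at t))"

definition C1_on :: "(real \<Rightarrow> real) \<Rightarrow> real set \<Rightarrow> bool" where
  "C1_on f S \<longleftrightarrow> (\<exists>f'. has_C1_deriv_on f f' S)"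


text \<open>The formula is meant for \<open>n > 0\<close>; at \<open>n = 0\<close>, where \<open>\<rho>0 s / s\<close> has no
  derivative in the mathematical sense, the factor \<open>n\<^sup>2\<close> makes the value \<open>0\<close>, which is the
  value demanded by the assumptions on the fluid below.\<close>

definition fluid_pressure :: "(real \<Rightarrow> real) \<Rightarrow> real \<Rightarrow> real" where
  "fluid_pressure \<rho>0 n = n\<^sup>2 * deriv (\<lambda>s. \<rho>0 s / s) n"

definition fluid_F1 :: "(real \<Rightarrow> real) \<Rightarrow> bool" where
  "fluid_F1 \<rho>0 \<longleftrightarrow>
     C1_on \<rho>0 {0..} \<and>
     (\<forall>n\<ge>0. \<rho>0 n \<ge> 0 \<and> (\<rho>0 n = 0 \<longleftrightarrow> n = 0)) \<and>
     Bfun (\<lambda>n. \<rho>0 n / n powr (2/3)) (at_right 0)"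

definition fluid_F2 :: "(real \<Rightarrow> real) \<Rightarrow> bool" where
  "fluid_F2 p0 \<longleftrightarrow>
     (\<exists>p0'. has_C1_deriv_on p0 p0' {0..} \<and>
        (\<forall>n\<ge>0. p0 n \<ge> 0 \<and> (p0 n = 0 \<longleftrightarrow> n = 0) \<and> p0' n \<ge> 0 \<and> (p0' n = 0 \<longleftrightarrow> n = 0))) \<and>
     Bfun (\<lambda>n. p0 n / n powr (2/3)) (at_right 0)"

definition fluid_F3 :: "(real \<Rightarrow> real) \<Rightarrow> (real \<Rightarrow> real) \<Rightarrow> bool" where
  "fluid_F3 \<rho>0 p0 \<longleftrightarrow> (\<forall>n\<ge>0. p0 n \<le> \<rho>0 n)"


definition particle_density :: "real \<Rightarrow> real \<Rightarrow> real" where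
  "particle_density x y = y * sqrt x"

definition john_factor :: "real \<Rightarrow> real \<Rightarrow> real \<Rightarrow> real" where
  "john_factor k x y = 1 + k * ((x + 2 * y) / particle_density x y powr (2/3) - 3)"

definition john_rho :: "real \<Rightarrow> (real \<Rightarrow> real) \<Rightarrow> real \<Rightarrow> real \<Rightarrow> real" where
  "john_rho k \<rho>0 x y =
     (if x = 0 \<or> y = 0 then 0 else \<rho>0 (particle_density x y) * john_factor k x y)"

definition john_prad :: "real \<Rightarrow> (real \<Rightarrow> real) \<Rightarrow> real \<Rightarrow> real \<Rightarrow> real" where
  "john_prad k \<rho>0 x y =
     (if x = 0 \<or> y = 0 then 0
      else fluid_pressure \<rho>0 (particle_density x y) * john_factor k x y
           + \<rho>0 (particle_density x y) * (4 * k * (x - y) / (3 * particle_density x y powr (2/3))))"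

definition john_ptan :: "real \<Rightarrow> (real \<Rightarrow> real) \<Rightarrow> real \<Rightarrow> real \<Rightarrow> real" where
  "john_ptan k \<rho>0 x y =
     (if x = 0 \<or> y = 0 then 0
      else fluid_pressure \<rho>0 (particle_density x y) * john_factor k x y
           - \<rho>0 (particle_density x y) * (2 * k * (x - y) / (3 * particle_density x y powr (2/3))))"


definition dx_prad :: "real \<Rightarrow> (real \<Rightarrow> real) \<Rightarrow> real \<Rightarrow> real \<Rightarrow> real" where
  "dx_prad k \<rho>0 x y = deriv (\<lambda>s. john_prad k \<rho>0 s y) x"

definition dy_prad :: "real \<Rightarrow> (real \<Rightarrow> real) \<Rightarrow> real \<Rightarrow> real \<Rightarrow> real" where
  "dy_prad k \<rho>0 x y = deriv (\<lambda>s. john_prad k \<rho>0 x s) y"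

text \<open>The first conjunct says that the quotient in the equation for \<open>x\<close> is a genuine one; as
  division by zero yields zero, omitting it would admit \<open>x' = 0\<close> wherever the denominator
  vanishes.\<close>

definition solves_system_at ::
  "real \<Rightarrow> (real \<Rightarrow> real) \<Rightarrow> (real \<Rightarrow> real) \<Rightarrow> (real \<Rightarrow> real) \<Rightarrow> (real \<Rightarrow> real) \<Rightarrow> real \<Rightarrow> bool" where
  "solves_system_at k \<rho>0 x y m r \<longleftrightarrow>
     dx_prad k \<rho>0 (x r) (y r) \<noteq> 0 \<and>
     (x has_real_derivative
        1 / dx_prad k \<rho>0 (x r) (y r) *
        (- (john_prad k \<rho>0 (x r) (y r) + john_rho k \<rho>0 (x r) (y r)) *
             ((m r + r ^ 3 * john_prad k \<rho>0 (x r) (y r) / 2) / (r * (r - 2 * m r)))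
         + 2 / r * (john_ptan k \<rho>0 (x r) (y r) - john_prad k \<rho>0 (x r) (y r))
         - deriv y r * dy_prad k \<rho>0 (x r) (y r))) (at r) \<and>
     (y has_real_derivative
        2 / r * (sqrt (r / (r - 2 * m r) * x r * y r) - y r)) (at r) \<and>
     (m has_real_derivative 1 / 2 * r\<^sup>2 * john_rho k \<rho>0 (x r) (y r)) (at r)"

definition regular_ball ::
  "real \<Rightarrow> (real \<Rightarrow> real) \<Rightarrow> real \<Rightarrow> real \<Rightarrow>
     (real \<Rightarrow> real) \<Rightarrow> (real \<Rightarrow> real) \<Rightarrow> (real \<Rightarrow> real) \<Rightarrow> bool" where
  "regular_ball k \<rho>0 R M x y m \<longleftrightarrow>
     R > 0 \<and> M > 0 \<and>
     C1_on x {0..R} \<and> C1_on y {0..R} \<and> C1_on m {0..R} \<and>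
     (x 0 = y 0 \<and> x 0 > 0 \<and> m 0 = 0) \<and>
     (\<forall>r\<in>{0..<R}. x r > 0 \<and> y r > 0) \<and>
     (\<forall>r>0. 0 < 2 * m r \<and> 2 * m r < r) \<and>
     (\<forall>r>R. x r = 0 \<and> y r = 0 \<and> m r = m R) \<and> m R = M \<and>
     (\<forall>r\<in>{0..<R}. john_prad k \<rho>0 (x r) (y r) > 0) \<and> john_prad k \<rho>0 (x R) (y R) = 0 \<and>
     (\<forall>r\<in>{0<..<R}. solves_system_at k \<rho>0 x y m r)"

definition dominant_energy :: "(real \<Rightarrow> real) \<Rightarrow> (real \<Rightarrow> real) \<Rightarrow> real \<Rightarrow> bool" where
  "dominant_energy p \<rho> R \<longleftrightarrow> (\<forall>r\<in>{0..R}. \<bar>p r\<bar> \<le> \<rho> r)"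

end

theory Submission
  imports Defs
begin

text \<open>Everything follows from \<open>x < y\<close> on \<open>(0, R)\<close>: with \<open>w = p0 / \<rho>0\<close>,
  \<^term>\<open>john_prad\<close> is \<open>w \<rho>\<close> minus, and \<^term>\<open>john_ptan\<close> is \<open>w \<rho>\<close> plus, a
  positive multiple of \<open>y - x\<close>, and the latter excess is bounded by \<open>\<beta> \<rho>\<close> since
  \<open>3 n\<^bsup>2/3\<^esup> \<le> x + 2 y\<close>. At the boundary \<open>p\<^bsub>rad\<^esub> = 0\<close> turns the quotient
  \<open>p\<^bsub>tan\<^esub> / \<rho>\<close> into \<open>3 w / 2\<close>; for this one must exclude \<open>x R = 0\<close>, where by
  convention both functions vanish.\<close>

section \<open>The John factor and the AM-GM inequality behind it\<close>

abbreviation q23 :: "real \<Rightarrow> real \<Rightarrow> real" where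
  "q23 a b \<equiv> particle_density a b powr (2/3)"

lemma particle_density_pos: "a > 0 \<Longrightarrow> b > 0 \<Longrightarrow> particle_density a b > 0"
  by (simp add: particle_density_def)

text \<open>AM-GM for the three numbers \<open>a\<close>, \<open>b\<close>, \<open>b\<close>, since
  \<open>q23 a b\<close> is the cube root of \<open>a * b^2\<close>. With cube roots
  \<open>s\<close> and \<open>t\<close> the defect is
  \<open>(s - t)^2 * (s + 2 * t)\<close>.\<close>

lemma q23_le:
  assumes "a > 0" "b > 0"
  shows "3 * q23 a b \<le> a + 2 * b"
proof -
  define s where "s = a powr (1/3)"
  define t where "t = b powr (1/3)"
  have st: "s > 0" "t > 0" using assms by (auto simp: s_def t_def)
  have a: "a = s ^ 3" and b: "b = t ^ 3"
    using assms by (simp_all add: s_def t_def powr_powr flip: powr_realpow)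
  have "q23 a b = b powr (2/3) * a powr (1/3)"
    using assms by (simp add: particle_density_def powr_mult powr_half_sqrt[symmetric] powr_powr)
  also have "b powr (2/3) = t ^ 2"
    using assms by (simp add: t_def powr_powr flip: powr_realpow)
  finally have q: "q23 a b = t ^ 2 * s" by (simp add: s_def)
  have "s ^ 3 + 2 * t ^ 3 - 3 * (t ^ 2 * s) = (s - t) ^ 2 * (s + 2 * t)"
    by (simp add: power2_eq_square power3_eq_cube algebra_simps)
  also have "\<dots> \<ge> 0" using st by simp
  finally show ?thesis unfolding q using a b by simp
qed

lemma john_factor_ge_1:
  assumes "k \<ge> 0" "a > 0" "b > 0"
  shows "john_factor k a b \<ge> 1"
proof -
  have "q23 a b > 0" using particle_density_pos[of a b] assms by simp
  then have "(a + 2 * b) / q23 a b \<ge> 3"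
    using q23_le[of a b] assms by (simp add: le_divide_eq)
  then show ?thesis using assms by (simp add: john_factor_def)
qed

text \<open>Clearing the denominator leaves an expression linear in \<open>a\<close>,
  \<open>b\<close> and \<open>q23 a b\<close>. It keeps a finite limit as \<open>a\<close> tends to
  0, where the factor itself blows up.\<close>

lemma q23_john_factor:
  assumes "a > 0" "b > 0"
  shows "q23 a b * john_factor k a b = (1 - 3 * k) * q23 a b + k * (a + 2 * b)"
proof -
  have "particle_density a b > 0" using particle_density_pos[of a b] assms by simp
  then show ?thesis by (simp add: john_factor_def field_simps)
qed

text \<open>On the diagonal there is no shear, so the material behaves there as the underlying
  fluid.\<close>

lemma john_diag:
  assumes "a > 0"
  shows "q23 a a = a" "john_factor k a a = 1"
proof -
  have "particle_density a a = a powr 1 * a powr (1/2)"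
    using assms by (simp add: particle_density_def powr_half_sqrt)
  also have "\<dots> = a powr (3/2)" unfolding powr_add[symmetric] by simp
  finally have "particle_density a a = a powr (3/2)" .
  then show q: "q23 a a = a" using assms by (simp add: powr_powr)
  show "john_factor k a a = 1" using assms unfolding john_factor_def q by simp
qed

section \<open>Consequences of the hypotheses on the fluid\<close>

locale john_fluid =
  fixes k :: real and \<rho>0 :: "real \<Rightarrow> real"
  assumes k: "k > 0"
    and F1: "fluid_F1 \<rho>0"
    and F2: "fluid_F2 (fluid_pressure \<rho>0)"
    and F3: "fluid_F3 \<rho>0 (fluid_pressure \<rho>0)"
begin

abbreviation "p0 \<equiv> fluid_pressure \<rho>0"

abbreviation "rhat \<equiv> john_rho k \<rho>0"
abbreviation "prhat \<equiv> john_prad k \<rho>0"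
abbreviation "pthat \<equiv> john_ptan k \<rho>0"

lemma continuous_on_\<rho>0: "continuous_on {0..} \<rho>0"
  and continuous_on_p0: "continuous_on {0..} p0"
  using F1 F2 by (auto simp: fluid_F1_def fluid_F2_def C1_on_def has_C1_deriv_on_def)

lemma \<rho>0_differentiable:
  assumes "n > 0" obtains d where "(\<rho>0 has_real_derivative d) (at n)"
  using F1 assms by (auto simp: fluid_F1_def C1_on_def has_C1_deriv_on_def)

lemma p0_differentiable:
  assumes "n > 0" obtains d where "d > 0" "(p0 has_real_derivative d) (at n)"
proof -
  obtain p0' where "has_C1_deriv_on p0 p0' {0..}"
    "\<forall>n\<ge>0. p0' n \<ge> 0 \<and> (p0' n = 0 \<longleftrightarrow> n = 0)"
    using F2 by (auto simp: fluid_F2_def)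
  with assms have "(p0 has_real_derivative p0' n) (at n)" "p0' n > 0"
    by (auto simp: has_C1_deriv_on_def less_le)
  with that show ?thesis by blast
qed

lemma \<rho>0_pos: "n > 0 \<Longrightarrow> \<rho>0 n > 0" and p0_pos: "n > 0 \<Longrightarrow> p0 n > 0"
  and \<rho>0_0: "\<rho>0 0 = 0" and p0_le: "n \<ge> 0 \<Longrightarrow> p0 n \<le> \<rho>0 n"
  using F1 F2 F3 by (auto simp: fluid_F1_def fluid_F2_def fluid_F3_def less_le)

lemma p0_mono:
  assumes "0 < s" "s \<le> t" shows "p0 s \<le> p0 t"
proof (rule DERIV_nonneg_imp_nondecreasing[OF assms(2)])
  fix n assume "s \<le> n"
  with assms(1) have "n > 0" by simp
  then obtain d where "d > 0" "(p0 has_real_derivative d) (at n)" by (rule p0_differentiable)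
  then show "\<exists>d. (p0 has_real_derivative d) (at n) \<and> 0 \<le> d" by force
qed

text \<open>The derivative of \<open>\<rho>0\<close> extends continuously to 0 and so is bounded on
  [0,1]; the mean value theorem does the rest. The bound forces
  \<open>\<rho>0 n / n powr (2/3)\<close> to tend to 0, where (F1) states only boundedness.\<close>

lemma \<rho>0_linear_bound:
  obtains C where "C > 0" "\<And>n. 0 \<le> n \<Longrightarrow> n \<le> 1 \<Longrightarrow> \<rho>0 n \<le> C * n"
proof -
  obtain d where d: "continuous_on {0..} d"
    "\<And>t. t > 0 \<Longrightarrow> (\<rho>0 has_real_derivative d t) (at t)"
    using F1 by (auto simp: fluid_F1_def C1_on_def has_C1_deriv_on_def)
  have "compact (d ` {0..1})"
    by (intro compact_continuous_image continuous_on_subset[OF d(1)]) auto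
  then obtain C where C: "C > 0" "\<And>t. t \<in> {0..1} \<Longrightarrow> \<bar>d t\<bar> \<le> C"
    using compact_imp_bounded bounded_pos by (metis image_eqI real_norm_def)
  have "\<rho>0 n \<le> C * n" if n: "0 \<le> n" "n \<le> 1" for n
  proof (cases "n = 0")
    case False
    then have "0 < n" using n by simp
    moreover have "continuous_on {0..n} \<rho>0"
      by (rule continuous_on_subset[OF continuous_on_\<rho>0]) auto
    ultimately obtain l z where z: "0 < z" "z < n" "DERIV \<rho>0 z :> l" "\<rho>0 n - \<rho>0 0 = (n - 0) * l"
      using MVT[of 0 n \<rho>0] d(2) real_differentiable_def by blast
    have "l = d z" using z d(2) DERIV_unique by blast
    moreover have "d z \<le> C" using C(2)[of z] z n by auto
    ultimately show ?thesis using z \<rho>0_0 \<open>0 < n\<close> by (simp add: mult.commute)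
  qed (simp add: \<rho>0_0)
  with C(1) that show ?thesis by blast
qed

section \<open>Material functions at a point with positive arguments\<close>

context
  fixes a b :: real
  assumes a: "a > 0" and b: "b > 0"
begin

text \<open>Both pressures become the ratio p0/\<rho>0 times the density plus a multiple of
  \<open>b - a\<close>, so the order of \<open>a\<close> and \<open>b\<close> decides the sign of
  every correction. The difference of the pressures is the anisotropy term of the equilibrium
  equation.\<close>

lemma rhat_pos: "rhat a b > 0"
  and rhat_eq: "rhat a b = \<rho>0 (particle_density a b) / q23 a b
      * ((1 - 3 * k) * q23 a b + k * (a + 2 * b))"
  and prhat_eq: "prhat a b = p0 (particle_density a b) / \<rho>0 (particle_density a b) * rhat a b
      - \<rho>0 (particle_density a b) / q23 a b * (4 * k * (b - a) / 3)"
  and pthat_eq: "pthat a b = p0 (particle_density a b) / \<rho>0 (particle_density a b) * rhat a b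
      + \<rho>0 (particle_density a b) / q23 a b * (2 * k * (b - a) / 3)"
  and pthat_minus_prhat:
    "pthat a b - prhat a b = \<rho>0 (particle_density a b) / q23 a b * (2 * k * (b - a))"
proof -
  have n: "particle_density a b > 0" using particle_density_pos[of a b] a b by simp
  have F: "john_factor k a b \<ge> 1" using john_factor_ge_1 k a b by simp
  show "rhat a b > 0" using n F a b \<rho>0_pos[OF n] by (simp add: john_rho_def)
  show "rhat a b = \<rho>0 (particle_density a b) / q23 a b
      * ((1 - 3 * k) * q23 a b + k * (a + 2 * b))"
    using n a b by (simp add: john_rho_def flip: q23_john_factor)
  show pr: "prhat a b = p0 (particle_density a b) / \<rho>0 (particle_density a b) * rhat a b
      - \<rho>0 (particle_density a b) / q23 a b * (4 * k * (b - a) / 3)"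
    using a b n \<rho>0_pos[OF n] by (simp add: john_prad_def john_rho_def field_simps)
  show pt: "pthat a b = p0 (particle_density a b) / \<rho>0 (particle_density a b) * rhat a b
      + \<rho>0 (particle_density a b) / q23 a b * (2 * k * (b - a) / 3)"
    using a b n \<rho>0_pos[OF n] by (simp add: john_ptan_def john_rho_def field_simps)
  have w: "w * (2 * k * (b - a) / 3) + w * (4 * k * (b - a) / 3) = w * (2 * k * (b - a))" for w
    by (simp add: field_simps)
  show "pthat a b - prhat a b = \<rho>0 (particle_density a b) / q23 a b * (2 * k * (b - a))"
    unfolding pr pt using w[of "\<rho>0 (particle_density a b) / q23 a b"] by simp
qed

lemma prhat_less:
  assumes "a < b"
  shows "prhat a b < p0 (particle_density a b) / \<rho>0 (particle_density a b) * rhat a b"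
  using assms k a b \<rho>0_pos[OF particle_density_pos] particle_density_pos[OF a b]
  by (simp add: prhat_eq)

lemma prhat_le_rhat:
  assumes "a \<le> b"
  shows "prhat a b \<le> rhat a b"
proof -
  have n: "particle_density a b > 0" using particle_density_pos[of a b] a b by simp
  have "p0 (particle_density a b) / \<rho>0 (particle_density a b) \<le> 1"
    using p0_le[of "particle_density a b"] \<rho>0_pos[OF n] n by simp
  then have "p0 (particle_density a b) / \<rho>0 (particle_density a b) * rhat a b \<le> 1 * rhat a b"
    using rhat_pos by (intro mult_right_mono) auto
  moreover have "\<rho>0 (particle_density a b) / q23 a b * (4 * k * (b - a) / 3) \<ge> 0"
    using \<rho>0_pos[OF n] k assms by simp
  ultimately show ?thesis unfolding prhat_eq by linarith
qed

text \<open>For \<open>b \<le> a\<close> the John factor is at least 1 and the shear term is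
  nonnegative. This compares the radial pressure with a monotone function of the particle density
  alone.\<close>

lemma p0_le_prhat:
  assumes "b \<le> a"
  shows "p0 (particle_density a b) \<le> prhat a b"
proof -
  have n: "particle_density a b > 0" using particle_density_pos[of a b] a b by simp
  have "p0 (particle_density a b) * 1 \<le> p0 (particle_density a b) * john_factor k a b"
    using john_factor_ge_1[of k a b] k a b p0_pos[OF n] by (intro mult_left_mono) auto
  moreover have "\<rho>0 (particle_density a b) * (4 * k * (a - b) / (3 * q23 a b)) \<ge> 0"
    using \<rho>0_pos[OF n] k assms by simp
  ultimately show ?thesis using a b by (simp add: john_prad_def)
qed

text \<open>The shear excess is compared with \<open>\<beta>\<close> times the density after
  division by the common factor \<open>\<rho>0 / q23\<close>. For \<open>k \<le> 1/3\<close> the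
  \<open>q23\<close> term of the density is nonnegative and is dropped; for \<open>k > 1/3\<close>
  it is negative and is controlled by AM-GM. In both cases a positive multiple of \<open>a\<close>
  remains, which makes the inequality strict.\<close>

lemma pthat_bounds:
  assumes "a \<le> b" "\<beta> = max k (1/3)"
  shows "0 < pthat a b"
    and "pthat a b < (p0 (particle_density a b) / \<rho>0 (particle_density a b) + \<beta>) * rhat a b"
proof -
  have n: "particle_density a b > 0" using particle_density_pos[of a b] a b by simp
  define q where "q = q23 a b"
  have q: "q > 0" "3 * q \<le> a + 2 * b" using n q23_le a b by (auto simp: q_def)
  note r = \<rho>0_pos[OF n]
  show "0 < pthat a b"
    unfolding pthat_eq using r p0_pos[OF n] rhat_pos k assms n by (intro add_pos_nonneg) auto
  have "2 * k * (b - a) / 3 < \<beta> * ((1 - 3 * k) * q + k * (a + 2 * b))"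
  proof (cases "k \<le> 1/3")
    case True
    then have "(1 - 3 * k) * q \<ge> 0" using q by simp
    moreover have "k * a > 0" using k a by simp
    moreover have \<beta>: "\<beta> = 1/3" using True assms(2) by simp
    ultimately show ?thesis unfolding \<beta> by (simp add: field_simps)
  next
    case False
    have "(3 * k - 1) * (3 * q) \<le> (3 * k - 1) * (a + 2 * b)"
      using q False by (intro mult_left_mono) auto
    then have "2 * (b - a) / 3 < (1 - 3 * k) * q + k * (a + 2 * b)"
      using a by (simp add: field_simps)
    from mult_strict_left_mono[OF this k] show ?thesis using False assms(2)
      by (simp add: max_def algebra_simps)
  qed
  then have "\<rho>0 (particle_density a b) / q * (2 * k * (b - a) / 3)
      < \<rho>0 (particle_density a b) / q * (\<beta> * ((1 - 3 * k) * q + k * (a + 2 * b)))"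
    using q r by (intro mult_strict_left_mono) auto
  also have "\<dots> = \<beta> * rhat a b" unfolding rhat_eq q_def by simp
  finally show "pthat a b
      < (p0 (particle_density a b) / \<rho>0 (particle_density a b) + \<beta>) * rhat a b"
    unfolding pthat_eq q_def by (simp add: algebra_simps)
qed

text \<open>\<open>A\<close> and \<open>B\<close> are the values of the Frechet derivative on the
  basis vectors. They are fixed before the curve \<open>(u, v)\<close>, so the same pair serves
  every curve through \<open>(a, b)\<close>.\<close>

lemma prhat_total_derivative:
  obtains A B where
    "\<And>u v U V t. u t = a \<Longrightarrow> v t = b \<Longrightarrow> (u has_real_derivative U) (at t) \<Longrightarrow>
       (v has_real_derivative V) (at t) \<Longrightarrow>
       ((\<lambda>s. prhat (u s) (v s)) has_real_derivative A * U + B * V) (at t)"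
proof -
  let ?n = "\<lambda>z. particle_density (fst z) (snd z)"
  \<comment> \<open>The formula of \<open>john_prad\<close> without its case distinction; the two
    agree near \<open>(a, b)\<close> because both arguments stay positive there.\<close>
  let ?P = "\<lambda>z. p0 (?n z) * (1 + k * ((fst z + 2 * snd z) / ?n z powr (2/3) - 3))
        + \<rho>0 (?n z) * (4 * k * (fst z - snd z) / (3 * ?n z powr (2/3)))"
  have n: "?n (a, b) > 0" using particle_density_pos a b by simp
  have comp: "(\<lambda>z. f (g z)) differentiable (at (a, b))"
    if "(f has_real_derivative d) (at (g (a, b)))" "g differentiable (at (a, b))"
    for f g :: "_ \<Rightarrow> real" and d
    using differentiable_chain_at[of g "(a, b)" f] that
    by (auto simp: o_def has_field_derivative_def differentiable_def)
  have "(\<lambda>z. sqrt (fst z)) differentiable (at (a, b))"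
    using a by (intro comp[OF DERIV_real_sqrt]) (auto intro: bounded_linear_imp_differentiable bounded_linear_fst)
  moreover have lin: "fst differentiable (at (a, b))" "snd differentiable (at (a, b))"
    by (auto intro: bounded_linear_imp_differentiable bounded_linear_fst bounded_linear_snd)
  ultimately have dn: "?n differentiable (at (a, b))"
    unfolding particle_density_def by (intro derivative_intros)
  obtain P where P: "(p0 has_real_derivative P) (at (?n (a, b)))"
    by (rule p0_differentiable[OF n])
  obtain D where D: "(\<rho>0 has_real_derivative D) (at (?n (a, b)))"
    by (rule \<rho>0_differentiable[OF n])
  note q = has_real_derivative_powr[OF n, of "2/3"]
  have "?P differentiable (at (a, b))"
    using n by (intro differentiable_add differentiable_mult differentiable_diff
        differentiable_divide differentiable_const lin comp[OF P dn] comp[OF D dn] comp[OF q dn]) auto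
  then obtain P' where P': "(?P has_derivative P') (at (a, b))"
    by (auto simp: differentiable_def)
  interpret P': bounded_linear P' using P' by (rule has_derivative_bounded_linear)
  show thesis
  proof (rule that)
    fix u v :: "real \<Rightarrow> real" and U V t :: real
    assume uv: "u t = a" "v t = b" and u: "(u has_real_derivative U) (at t)"
      and v: "(v has_real_derivative V) (at t)"
    have "((\<lambda>s. (u s, v s)) has_derivative (\<lambda>h. (U * h, V * h))) (at t)"
      using u v unfolding has_field_derivative_def by (rule has_derivative_Pair)
    from diff_chain_at[OF this, of ?P P'] P' uv
    have "((\<lambda>s. ?P (u s, v s)) has_derivative (\<lambda>h. P' (U * h, V * h))) (at t)"
      by (simp add: o_def)
    moreover have "P' (U * h, V * h) = (P' (1, 0) * U + P' (0, 1) * V) * h" for h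
      using P'.add[of "(U * h) *\<^sub>R (1, 0)" "(V * h) *\<^sub>R (0, 1)"]
      by (simp only: P'.scaleR) (simp add: algebra_simps)
    ultimately have "((\<lambda>s. ?P (u s, v s)) has_real_derivative P' (1, 0) * U + P' (0, 1) * V) (at t)"
      by (simp add: has_field_derivative_def)
    moreover have "(u \<longlongrightarrow> a) (nhds t)" "(v \<longlongrightarrow> b) (nhds t)"
      using DERIV_isCont[OF u] DERIV_isCont[OF v] uv
      by (auto simp: isCont_def tendsto_at_iff_tendsto_nhds)
    then have "\<forall>\<^sub>F s in nhds t. u s > 0" "\<forall>\<^sub>F s in nhds t. v s > 0"
      using a b by (auto intro: order_tendstoD)
    then have "\<forall>\<^sub>F s in nhds t. prhat (u s) (v s) = ?P (u s, v s)"
      by eventually_elim (simp add: john_prad_def john_factor_def)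
    ultimately show "((\<lambda>s. prhat (u s) (v s)) has_real_derivative
        P' (1, 0) * U + P' (0, 1) * V) (at t)"
      by (simp add: DERIV_cong_ev[OF refl _ refl])
  qed
qed

lemma prhat_chain_rule:
  assumes "u t = a" "v t = b" "(u has_real_derivative U) (at t)" "(v has_real_derivative V) (at t)"
  shows "((\<lambda>s. prhat (u s) (v s)) has_real_derivative
     dx_prad k \<rho>0 a b * U + dy_prad k \<rho>0 a b * V) (at t)"
proof -
  obtain A B where AB: "\<And>u v U V t. u t = a \<Longrightarrow> v t = b \<Longrightarrow> (u has_real_derivative U) (at t) \<Longrightarrow>
       (v has_real_derivative V) (at t) \<Longrightarrow>
       ((\<lambda>s. prhat (u s) (v s)) has_real_derivative A * U + B * V) (at t)"
    using prhat_total_derivative by blast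
  \<comment> \<open>The two coordinate lines through \<open>(a, b)\<close> identify \<open>A\<close>
    and \<open>B\<close> with the partial derivatives.\<close>
  have "dx_prad k \<rho>0 a b = A" "dy_prad k \<rho>0 a b = B"
    using AB[of "\<lambda>s. s" a "\<lambda>_. b" 1 0] AB[of "\<lambda>_. a" b "\<lambda>s. s" 0 1]
    by (auto simp: dx_prad_def dy_prad_def DERIV_imp_deriv)
  with AB assms show ?thesis by blast
qed

end

text \<open>Positivity of \<open>u\<close> and \<open>v\<close> keeps away from the conventional
  zero values. The lemma thus applies on [0,R), and on [0,R] once \<open>x R > 0\<close> is
  known.\<close>

lemma continuous_on_hats:
  assumes "continuous_on S u" "continuous_on S v" "\<And>s. s \<in> S \<Longrightarrow> u s > 0 \<and> v s > 0"
  shows "continuous_on S (\<lambda>s. p0 (particle_density (u s) (v s)))"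
    and "continuous_on S (\<lambda>s. \<rho>0 (particle_density (u s) (v s)))"
    and "continuous_on S (\<lambda>s. rhat (u s) (v s))"
    and "continuous_on S (\<lambda>s. prhat (u s) (v s))"
    and "continuous_on S (\<lambda>s. pthat (u s) (v s))"
proof -
  let ?n = "\<lambda>s. particle_density (u s) (v s)"
  have n: "continuous_on S ?n"
    unfolding particle_density_def by (intro continuous_intros assms)
  have npos: "?n s > 0" if "s \<in> S" for s using assms(3) that particle_density_pos by blast
  show p: "continuous_on S (\<lambda>s. p0 (?n s))" and r: "continuous_on S (\<lambda>s. \<rho>0 (?n s))"
    using npos by (intro continuous_on_compose2[OF continuous_on_p0 n]
        continuous_on_compose2[OF continuous_on_\<rho>0 n]; force)+
  have q: "continuous_on S (\<lambda>s. q23 (u s) (v s))"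
    by (intro continuous_on_powr n continuous_on_const) (use npos in force)
  have q0: "\<forall>s\<in>S. q23 (u s) (v s) \<noteq> 0" "\<forall>s\<in>S. 3 * q23 (u s) (v s) \<noteq> 0"
    using npos by force+
  have F: "continuous_on S (\<lambda>s. john_factor k (u s) (v s))"
    unfolding john_factor_def
    by (intro continuous_on_add continuous_on_mult continuous_on_diff continuous_on_divide
        continuous_on_const q q0 assms)
  have "continuous_on S (\<lambda>s. \<rho>0 (?n s) * john_factor k (u s) (v s))"
    by (intro continuous_on_mult r F)
  then show "continuous_on S (\<lambda>s. rhat (u s) (v s))"
    by (rule continuous_on_eq) (use assms(3) in \<open>force simp: john_rho_def\<close>)
  have "continuous_on S (\<lambda>s. p0 (?n s) * john_factor k (u s) (v s)
      + \<rho>0 (?n s) * (4 * k * (u s - v s) / (3 * q23 (u s) (v s))))"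
    by (intro continuous_on_add continuous_on_mult continuous_on_diff continuous_on_divide
        continuous_on_const p r q q0 F assms)
  then show "continuous_on S (\<lambda>s. prhat (u s) (v s))"
    by (rule continuous_on_eq) (use assms(3) in \<open>force simp: john_prad_def\<close>)
  have "continuous_on S (\<lambda>s. p0 (?n s) * john_factor k (u s) (v s)
      - \<rho>0 (?n s) * (2 * k * (u s - v s) / (3 * q23 (u s) (v s))))"
    by (intro continuous_on_add continuous_on_mult continuous_on_diff continuous_on_divide
        continuous_on_const p r q q0 F assms)
  then show "continuous_on S (\<lambda>s. pthat (u s) (v s))"
    by (rule continuous_on_eq) (use assms(3) in \<open>force simp: john_ptan_def\<close>)
qed

lemma prhat_diag: "a > 0 \<Longrightarrow> prhat a a = p0 (particle_density a a)"
  by (simp add: john_prad_def john_diag)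

text \<open>The sum of the partials is the derivative along the diagonal, where the radial pressure
  is \<open>p0 (s * sqrt s)\<close>, a composition of increasing functions.\<close>

lemma dx_prad_plus_dy_prad_diag:
  assumes "a > 0"
  shows "dx_prad k \<rho>0 a a + dy_prad k \<rho>0 a a \<ge> 0"
proof -
  have "((\<lambda>s. prhat s s) has_real_derivative dx_prad k \<rho>0 a a * 1 + dy_prad k \<rho>0 a a * 1) (at a)"
    using prhat_chain_rule[OF assms assms, of "\<lambda>s. s" a "\<lambda>s. s" 1 1] by simp
  moreover obtain d where d: "d > 0" "(p0 has_real_derivative d) (at (a * sqrt a))"
    using p0_differentiable[of "a * sqrt a"] assms by auto
  have "((\<lambda>s. s * sqrt s) has_real_derivative (1 * sqrt a + inverse (sqrt a) / 2 * a)) (at a)"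
    by (rule DERIV_mult[OF DERIV_ident DERIV_real_sqrt[OF assms]])
  from DERIV_chain2[OF d(2) this]
  have "((\<lambda>s. prhat s s) has_real_derivative d * (1 * sqrt a + inverse (sqrt a) / 2 * a)) (at a)"
  proof (rule has_field_derivative_transform_within_open[of _ _ _ "{0<..}"])
    show "p0 (s * sqrt s) = prhat s s" if "s \<in> {0<..}" for s
      using that by (simp add: prhat_diag particle_density_def)
  qed (use assms in auto)
  ultimately have "dx_prad k \<rho>0 a a + dy_prad k \<rho>0 a a
      = d * (1 * sqrt a + inverse (sqrt a) / 2 * a)"
    using DERIV_unique by fastforce
  also have "\<dots> \<ge> 0" using d assms by simp
  finally show ?thesis .
qed

end

section \<open>The equilibrium equations along a regular ball solution\<close>

locale john_ball = john_fluid +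
  fixes R M :: real and x y m :: "real \<Rightarrow> real"
  assumes ball: "regular_ball k \<rho>0 R M x y m"
begin

abbreviation "nr r \<equiv> particle_density (x r) (y r)"
abbreviation "\<rho>r r \<equiv> rhat (x r) (y r)"
abbreviation "pradr r \<equiv> prhat (x r) (y r)"
abbreviation "ptanr r \<equiv> pthat (x r) (y r)"

lemma R_pos: "R > 0" and center: "x 0 = y 0"
  using ball by (simp_all add: regular_ball_def)

lemma xy_pos:
  assumes "0 \<le> r" "r < R" shows "x r > 0" "y r > 0"
  using ball assms by (simp_all add: regular_ball_def)

lemma m_bounds:
  assumes "r > 0" shows "m r > 0" "2 * m r < r"
  using ball assms unfolding regular_ball_def by fastforce+

lemma pradr_pos: "0 \<le> r \<Longrightarrow> r < R \<Longrightarrow> pradr r > 0" and pradr_R: "pradr R = 0"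
  using ball by (simp_all add: regular_ball_def)

lemma solves: "0 < r \<Longrightarrow> r < R \<Longrightarrow> solves_system_at k \<rho>0 x y m r"
  using ball by (simp add: regular_ball_def)

lemma continuous_on_xym: "continuous_on {0..R} x" "continuous_on {0..R} y" "continuous_on {0..R} m"
  using ball unfolding regular_ball_def C1_on_def has_C1_deriv_on_def by blast+

lemma y_deriv:
  assumes "0 < r" "r < R"
  shows "(y has_real_derivative 2 / r * (sqrt (r / (r - 2 * m r) * x r * y r) - y r)) (at r)"
  using solves[OF assms] by (simp add: solves_system_at_def)

text \<open>The equation for \<open>x'\<close> is the equilibrium equation solved for
  \<open>x'\<close>. The chain rule undoes this: the denominator cancels and the two
  \<open>y'\<close> terms annihilate each other.\<close>

lemma pradr_deriv:
  assumes "0 < r" "r < R"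
  shows "(pradr has_real_derivative
     - (pradr r + \<rho>r r) * ((m r + r ^ 3 * pradr r / 2) / (r * (r - 2 * m r)))
     + 2 / r * (ptanr r - pradr r)) (at r)"
proof -
  let ?d = "dx_prad k \<rho>0 (x r) (y r)" and ?e = "dy_prad k \<rho>0 (x r) (y r)"
  let ?E = "- (pradr r + \<rho>r r) * ((m r + r ^ 3 * pradr r / 2) / (r * (r - 2 * m r)))
     + 2 / r * (ptanr r - pradr r)"
  have d: "?d \<noteq> 0" and
    x: "(x has_real_derivative 1 / ?d * (?E - deriv y r * ?e)) (at r)"
    using solves[OF assms] unfolding solves_system_at_def by blast+
  have y: "(y has_real_derivative deriv y r) (at r)"
    unfolding DERIV_imp_deriv[OF y_deriv[OF assms]] by (rule y_deriv[OF assms])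
  have "(pradr has_real_derivative ?d * (1 / ?d * (?E - deriv y r * ?e)) + ?e * deriv y r) (at r)"
    using assms by (intro prhat_chain_rule xy_pos x y) auto
  also have "?d * (1 / ?d * (?E - deriv y r * ?e)) + ?e * deriv y r = ?E"
    using d by simp
  finally show ?thesis .
qed

section \<open>The ordering x < y in the interior\<close>

lemma y_deriv_pos:
  assumes "0 < r" "r < R" "y r \<le> x r"
  shows "2 / r * (sqrt (r / (r - 2 * m r) * x r * y r) - y r) > 0"
proof -
  have y: "y r > 0" using xy_pos assms by simp
  have f: "r / (r - 2 * m r) > 1" using m_bounds[of r] assms by simp
  have "(y r)\<^sup>2 \<le> x r * y r" using y assms by (simp add: power2_eq_square)
  also have "\<dots> < r / (r - 2 * m r) * (x r * y r)"
    using mult_strict_right_mono[OF f, of "x r * y r"] y assms by simp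
  finally have "y r < sqrt (r / (r - 2 * m r) * x r * y r)"
    by (intro real_less_rsqrt) (simp add: mult.assoc)
  then show ?thesis using assms by simp
qed

text \<open>The gravitational term is strictly negative, and for \<open>y r \<le> x r\<close> the
  anisotropy term has the same sign or vanishes.\<close>

lemma pradr_deriv_neg:
  assumes "0 < r" "r < R" "y r \<le> x r"
  shows "- (pradr r + \<rho>r r) * ((m r + r ^ 3 * pradr r / 2) / (r * (r - 2 * m r)))
     + 2 / r * (ptanr r - pradr r) < 0"
proof -
  have xy: "x r > 0" "y r > 0" using xy_pos assms by simp_all
  have "(pradr r + \<rho>r r) * ((m r + r ^ 3 * pradr r / 2) / (r * (r - 2 * m r))) > 0"
    using assms m_bounds[of r] pradr_pos[of r] rhat_pos[OF xy] by (simp add: add_pos_pos)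
  moreover have "\<rho>0 (nr r) / q23 (x r) (y r) \<ge> 0"
    using \<rho>0_pos[OF particle_density_pos[OF xy]] by simp
  then have "\<rho>0 (nr r) / q23 (x r) (y r) * (2 * k * (y r - x r)) \<le> 0"
    using k assms by (intro mult_nonneg_nonpos) auto
  then have "2 / r * (ptanr r - pradr r) \<le> 0"
    unfolding pthat_minus_prhat[OF xy]
    by (rule mult_nonneg_nonpos[rotated]) (use assms in simp)
  ultimately show ?thesis unfolding mult_minus_left by linarith
qed

lemma continuous_on_pradr: "continuous_on {0..<R} pradr"
  using xy_pos
  by (intro continuous_on_hats continuous_on_subset[OF continuous_on_xym(1)]
      continuous_on_subset[OF continuous_on_xym(2)]) auto

text \<open>If \<open>x\<close> exceeded \<open>y\<close>, then past the last radius where they agree \<open>y\<close> and hence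
  \<open>n\<close> would increase while the radial pressure decreases; but the radial pressure equals
  \<open>p0 n\<close> where \<open>x = y\<close> and is at least \<open>p0 n\<close> where \<open>x \<ge> y\<close>.\<close>

lemma x_le_y:
  assumes "0 \<le> r1" "r1 < R"
  shows "x r1 \<le> y r1"
proof (rule ccontr)
  assume "\<not> x r1 \<le> y r1"
  then have gt: "x r1 > y r1" by simp
  let ?D = "\<lambda>t. x t - y t"
  have cD: "continuous_on {a..b} ?D" if "0 \<le> a" "b < R" for a b
    using that by (intro continuous_intros continuous_on_subset[OF continuous_on_xym(1)]
        continuous_on_subset[OF continuous_on_xym(2)]) auto
  define S where "S = {t \<in> {0..r1}. ?D t = 0}"
  have "closed S" unfolding S_def
    using cD[of 0 r1] assms by (intro continuous_closed_preimage_constant) auto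
  moreover have "S \<subseteq> {0..r1}" by (auto simp: S_def)
  ultimately have "compact S"
    using bounded_subset[OF bounded_closed_interval] compact_eq_bounded_closed by blast
  moreover have "0 \<in> S" using center assms by (simp add: S_def)
  ultimately obtain r0 where r0: "r0 \<in> S" and r0_max: "\<And>t. t \<in> S \<Longrightarrow> t \<le> r0"
    using compact_attains_sup[of S] by blast
  have eq: "x r0 = y r0" and r01: "0 \<le> r0" "r0 < r1"
    using r0 gt by (auto simp: S_def less_le)
  have above: "y t \<le> x t" if t: "r0 < t" "t < r1" for t
  proof (rule ccontr)
    assume "\<not> y t \<le> x t"
    then obtain z where "t \<le> z" "z \<le> r1" "?D z = 0"
      using IVT'[of ?D t 0 r1] cD[of t r1] t r01 assms gt by auto
    then have "z \<in> S" using t r01 by (simp add: S_def)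
    with r0_max[of z] \<open>t \<le> z\<close> t show False by simp
  qed
  have y_mono: "y r0 < y r1"
  proof (rule DERIV_pos_imp_increasing_open[where f = y, OF r01(2)])
    show "continuous_on {r0..r1} y"
      using r01 assms by (intro continuous_on_subset[OF continuous_on_xym(2)]) auto
    fix t assume t: "r0 < t" "t < r1"
    then show "\<exists>d. (y has_real_derivative d) (at t) \<and> 0 < d"
      using y_deriv[of t] y_deriv_pos[OF _ _ above[OF t]] r01 assms by auto
  qed
  have "pradr r1 < pradr r0"
  proof (rule DERIV_neg_imp_decreasing_open[where f = pradr, OF r01(2)])
    show "continuous_on {r0..r1} pradr"
      using r01 assms by (intro continuous_on_subset[OF continuous_on_pradr]) auto
    fix t assume t: "r0 < t" "t < r1"
    then have "0 < t" "t < R" using r01 assms by auto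
    with pradr_deriv pradr_deriv_neg[OF _ _ above[OF t]]
    show "\<exists>d. (pradr has_real_derivative d) (at t) \<and> d < 0" by blast
  qed
  also have "pradr r0 = p0 (nr r0)"
    using prhat_diag[of "y r0"] xy_pos r01 assms eq by simp
  also have "\<dots> \<le> p0 (nr r1)"
  proof (rule p0_mono)
    show "nr r0 > 0" using xy_pos r01 assms by (simp add: particle_density_pos)
    \<comment> \<open>Both factors grow: \<open>x r0 = y r0 < y r1 < x r1\<close>.\<close>
    show "nr r0 \<le> nr r1"
      unfolding particle_density_def using y_mono gt eq xy_pos(2)[of r0] r01 assms
      by (intro mult_mono) auto
  qed
  also have "\<dots> \<le> pradr r1" using xy_pos assms gt by (intro p0_le_prhat) auto
  finally show False by simp
qed

text \<open>At an interior contact point \<open>x\<close> and \<open>y\<close> would have the same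
  derivative \<open>Y > 0\<close>. The radial pressure would then change at the rate of the diagonal
  derivative times \<open>Y\<close>, which is nonnegative, contrary to
  \<open>pradr_deriv_neg\<close>.\<close>

lemma x_less_y:
  assumes r: "0 < r" "r < R"
  shows "x r < y r"
proof (rule ccontr)
  assume "\<not> x r < y r"
  then have eq: "x r = y r" using x_le_y[of r] r by simp
  obtain X where X: "(x has_real_derivative X) (at r)"
    using solves[OF r] unfolding solves_system_at_def by blast
  define Y where "Y = 2 / r * (sqrt (r / (r - 2 * m r) * x r * y r) - y r)"
  have Y: "(y has_real_derivative Y) (at r)" "Y > 0"
    using y_deriv[OF r] y_deriv_pos[OF r] eq by (auto simp: Y_def)
  \<comment> \<open>By \<open>x_le_y\<close> the difference \<open>y - x\<close> is nonnegative and
    attains its minimum 0 at \<open>r\<close>; the chosen radius keeps the neighbourhood inside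
    (0,R).\<close>
  have "Y - X = 0"
  proof (rule DERIV_local_min[OF DERIV_diff[OF Y(1) X], of "min r (R - r)"])
    show "\<forall>t. \<bar>r - t\<bar> < min r (R - r) \<longrightarrow> y r - x r \<le> y t - x t"
      using x_le_y eq by auto
  qed (use r in simp)
  then have "(pradr has_real_derivative
      dx_prad k \<rho>0 (y r) (y r) * Y + dy_prad k \<rho>0 (y r) (y r) * Y) (at r)"
    using prhat_chain_rule[of "y r" "y r" x r y X Y] X Y eq xy_pos r by simp
  from DERIV_unique[OF this pradr_deriv[OF r]]
  have "dx_prad k \<rho>0 (y r) (y r) * Y + dy_prad k \<rho>0 (y r) (y r) * Y < 0"
    using pradr_deriv_neg[OF r] eq by simp
  moreover have "(dx_prad k \<rho>0 (y r) (y r) + dy_prad k \<rho>0 (y r) (y r)) * Y \<ge> 0"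
    using dx_prad_plus_dy_prad_diag[of "y r"] xy_pos r Y by (intro mult_nonneg_nonneg) auto
  ultimately show False by (simp add: algebra_simps)
qed

section \<open>Behaviour at the boundary radius\<close>

lemma eventually_at_left_R:
  "(\<And>r. 0 < r \<Longrightarrow> r < R \<Longrightarrow> Q r) \<Longrightarrow> \<forall>\<^sub>F r in at_left R. Q r"
  using R_pos by (intro eventually_at_leftI[of 0]) auto

lemma tendsto_at_R: "(x \<longlongrightarrow> x R) (at_left R)" "(y \<longlongrightarrow> y R) (at_left R)" "(m \<longlongrightarrow> m R) (at_left R)"
  using continuous_on_xym R_pos continuous_on_Icc_at_leftD by blast+

lemma x_R_nonneg: "x R \<ge> 0"
  using xy_pos(1)
  by (intro tendsto_lowerbound[OF tendsto_at_R(1)] eventually_at_left_R) (auto intro: less_imp_le)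

lemma x_R_le_y_R: "x R \<le> y R"
  by (rule tendsto_le[OF _ tendsto_at_R(2,1)])
    (auto intro!: eventually_at_left_R less_imp_le x_less_y)

text \<open>\<open>r\<^sup>2 y\<close> is nondecreasing, since \<open>y' \<ge> - 2 y / r\<close>.\<close>

lemma y_R_pos: "y R > 0"
proof -
  have "(R/2)\<^sup>2 * y (R/2) \<le> R\<^sup>2 * y R"
  proof (rule DERIV_nonneg_imp_increasing_open[where f = "\<lambda>r. r\<^sup>2 * y r"])
    fix r assume "R/2 < r" "r < R"
    then have r: "0 < r" "r < R" using R_pos by auto
    define s where "s = sqrt (r / (r - 2 * m r) * x r * y r)"
    have "((\<lambda>r. r\<^sup>2 * y r) has_real_derivative
        (real 2 * r ^ 1 * 1) * y r + (2 / r * (s - y r)) * r\<^sup>2) (at r)"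
      unfolding s_def using DERIV_mult[OF DERIV_power[OF DERIV_ident, of 2] y_deriv[OF r]]
      by (simp add: power2_eq_square)
    moreover have "(real 2 * r ^ 1 * 1) * y r + (2 / r * (s - y r)) * r\<^sup>2 = 2 * r * s"
      using r by (simp add: field_simps power2_eq_square)
    moreover have "2 * r * s \<ge> 0"
      using r xy_pos[of r] m_bounds[of r] by (simp add: s_def)
    ultimately show "\<exists>d. ((\<lambda>r. r\<^sup>2 * y r) has_real_derivative d) (at r) \<and> 0 \<le> d" by auto
  next
    show "continuous_on {R/2..R} (\<lambda>r. r\<^sup>2 * y r)"
      using R_pos by (intro continuous_intros continuous_on_subset[OF continuous_on_xym(2)]) auto
  qed (use R_pos in simp)
  moreover have "(R/2)\<^sup>2 * y (R/2) > 0" using xy_pos[of "R/2"] R_pos by simp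
  ultimately have "R\<^sup>2 * y R > 0" by linarith
  then show ?thesis using R_pos by (simp add: zero_less_mult_iff)
qed

text \<open>If \<open>x R = 0\<close>, then \<open>3 p0 / (2 \<rho>0) \<rightarrow> L > 1\<close> makes the radial pressure comparable to
  the density near \<open>R\<close>, so that the equilibrium equation bounds its logarithmic derivative from
  below and it cannot tend to \<open>0\<close> at \<open>R\<close>.\<close>

lemma x_R_pos:
  assumes lim: "((\<lambda>r. 3 * p0 (nr r) / (2 * \<rho>0 (nr r))) \<longlongrightarrow> L) (at_left R)" and L: "L > 1"
  shows "x R > 0"
proof (rule ccontr)
  assume "\<not> x R > 0"
  then have xR: "x R = 0" using x_R_nonneg by simp
  note lims = tendsto_at_R[unfolded xR]
  let ?q = "\<lambda>r. q23 (x r) (y r)"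
  \<comment> \<open>Here \<open>w\<close> is the common factor \<rho>0/n^(2/3), not the ratio
    p0/\<rho>0. The density is \<open>w * E\<close> and the radial pressure \<open>w * H\<close>:
    all decay sits in \<open>w\<close>, while \<open>E\<close> and \<open>H\<close> have positive
    limits.\<close>
  define w where "w = (\<lambda>r. \<rho>0 (nr r) / ?q r)"
  define E where "E = (\<lambda>r. (1 - 3 * k) * ?q r + k * (x r + 2 * y r))"
  define H where "H = (\<lambda>r. p0 (nr r) / \<rho>0 (nr r) * E r - 4 * k * (y r - x r) / 3)"
  define g where "g = (\<lambda>r. (m r + r ^ 3 * pradr r / 2) / (r * (r - 2 * m r)))"
  have n_lim: "(nr \<longlongrightarrow> 0) (at_left R)"
    unfolding particle_density_def using tendsto_mult[OF lims(2) tendsto_real_sqrt[OF lims(1)]] by simp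
  have n_pos: "nr r > 0" if "0 < r" "r < R" for r
    using that xy_pos by (simp add: particle_density_pos)
  have n_nonneg: "\<forall>\<^sub>F r in at_left R. 0 \<le> nr r"
    by (intro eventually_at_left_R less_imp_le n_pos)
  have q_lim: "(?q \<longlongrightarrow> 0) (at_left R)"
    using tendsto_powr'[OF n_lim tendsto_const[of "2/3"]] n_nonneg by simp
  have E_lim: "(E \<longlongrightarrow> 2 * k * y R) (at_left R)"
    unfolding E_def by (rule tendsto_eq_intros q_lim lims refl)+ simp
  have "((\<lambda>r. p0 (nr r) / \<rho>0 (nr r)) \<longlongrightarrow> 2 / 3 * L) (at_left R)"
    using tendsto_mult_left[OF lim, of "2/3"] by simp
  then have "(H \<longlongrightarrow> 2 / 3 * L * (2 * k * y R) - 4 * k * (y R - 0) / 3) (at_left R)"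
    unfolding H_def by (intro tendsto_intros E_lim lims) auto
  \<comment> \<open>The limit of \<open>H\<close> is positive precisely because
    \<open>L > 1\<close>.\<close>
  moreover define c where "c = 4 / 3 * k * y R * (L - 1)"
  then have "2 / 3 * L * (2 * k * y R) - 4 * k * (y R - 0) / 3 = c" by (simp add: field_simps)
  ultimately have H_lim: "(H \<longlongrightarrow> c) (at_left R)" by simp
  have c: "c > 0" using y_R_pos k L by (simp add: c_def)
  obtain C where C: "C > 0" "\<And>n. 0 \<le> n \<Longrightarrow> n \<le> 1 \<Longrightarrow> \<rho>0 n \<le> C * n"
    using \<rho>0_linear_bound by blast
  have w_pos: "w r > 0" if "0 < r" "r < R" for r
    using n_pos[OF that] \<rho>0_pos[of "nr r"] by (simp add: w_def)
  \<comment> \<open>For \<open>x R = 0\<close> the value \<open>pradr R = 0\<close> is a convention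
    and carries no information on the limit from the left. That limit is obtained from the decay of
    \<open>w\<close>, which is at most \<open>C\<close> times the cube root of the particle
    density.\<close>
  have "(w \<longlongrightarrow> 0) (at_left R)"
  proof (rule tendsto_sandwich)
    show "\<forall>\<^sub>F r in at_left R. 0 \<le> w r"
      by (intro eventually_at_left_R less_imp_le w_pos)
    have "\<forall>\<^sub>F r in at_left R. nr r < 1" using order_tendstoD(2)[OF n_lim] by simp
    moreover have "\<forall>\<^sub>F r in at_left R. nr r > 0" by (intro eventually_at_left_R n_pos)
    ultimately show "\<forall>\<^sub>F r in at_left R. w r \<le> C * nr r powr (1/3)"
    proof eventually_elim
      case (elim r)
      have "\<rho>0 (nr r) \<le> C * nr r" using C(2)[of "nr r"] elim by simp
      moreover have "nr r = nr r powr (1/3) * ?q r"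
        using elim by (simp flip: powr_add)
      ultimately have "\<rho>0 (nr r) \<le> C * nr r powr (1/3) * ?q r" by (simp add: mult.assoc)
      then show ?case using elim by (simp add: w_def divide_le_eq)
    qed
    have "((\<lambda>r. nr r powr (1/3)) \<longlongrightarrow> 0) (at_left R)"
      using tendsto_powr'[OF n_lim tendsto_const[of "1/3"]] n_nonneg by simp
    then show "((\<lambda>r. C * nr r powr (1/3)) \<longlongrightarrow> 0) (at_left R)"
      using tendsto_mult_left by fastforce
  qed auto
  have \<rho>_eq: "\<rho>r r = w r * E r" if "0 < r" "r < R" for r
    unfolding w_def E_def using rhat_eq xy_pos that by simp
  have prad_eq: "pradr r = w r * H r" if "0 < r" "r < R" for r
  proof -
    have xy: "x r > 0" "y r > 0" using xy_pos that by auto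
    have "c * (w r * E r) - w r * d = w r * (c * E r - d)" for c d by (simp add: algebra_simps)
    then show ?thesis
      unfolding prhat_eq[OF xy] \<rho>_eq[OF that] H_def w_def .
  qed
  have prad_lim: "(pradr \<longlongrightarrow> 0) (at_left R)"
  proof (rule Lim_transform_eventually)
    show "((\<lambda>r. w r * H r) \<longlongrightarrow> 0) (at_left R)"
      using tendsto_mult[OF \<open>(w \<longlongrightarrow> 0) (at_left R)\<close> H_lim] by simp
    show "\<forall>\<^sub>F r in at_left R. w r * H r = pradr r"
      by (intro eventually_at_left_R prad_eq[symmetric])
  qed
  have mR: "0 < m R" "2 * m R < R" using m_bounds R_pos by blast+
  have "(g \<longlongrightarrow> (m R + R ^ 3 * 0 / 2) / (R * (R - 2 * m R))) (at_left R)"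
    unfolding g_def using mR R_pos by (intro tendsto_intros lims prad_lim) auto
  moreover define G where "G = (m R + R ^ 3 * 0 / 2) / (R * (R - 2 * m R)) + 1"
  ultimately have "\<forall>\<^sub>F r in at_left R. g r < G" by (simp add: order_tendstoD(2))
  moreover define e where "e = 2 * k * y R + 1"
  then have "\<forall>\<^sub>F r in at_left R. E r < e" using order_tendstoD(2)[OF E_lim] by simp
  moreover have "\<forall>\<^sub>F r in at_left R. H r > c / 2"
    using order_tendstoD(1)[OF H_lim, of "c / 2"] c by simp
  moreover have "\<forall>\<^sub>F r in at_left R. 0 < r \<and> r < R" by (intro eventually_at_left_R) auto
  ultimately have "\<forall>\<^sub>F r in at_left R. g r < G \<and> E r < e \<and> c / 2 < H r \<and> 0 < r \<and> r < R"
    by eventually_elim auto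
  then obtain a where a: "a < R"
    "\<And>r. a < r \<Longrightarrow> r < R \<Longrightarrow> g r < G \<and> E r < e \<and> c / 2 < H r \<and> 0 < r \<and> r < R"
    using eventually_at_left[of "R - 1" R] by auto
  have e: "e > 0" using k y_R_pos by (simp add: e_def add_pos_pos)
  \<comment> \<open>Near \<open>R\<close> the density is at most \<open>e * w\<close> and the radial
    pressure at least \<open>c / 2 * w\<close>, so their sum is at most \<open>1 + 2 * e / c\<close>
    times the pressure; \<open>G\<close> bounds the gravitational factor \<open>g\<close>.\<close>
  define K where "K = (1 + 2 * e / c) * G"
  define s where "s = (a + R) / 2"
  have s: "a < s" "s < R" using a(1) by (auto simp: s_def)
  have lower: "\<exists>d. (pradr has_real_derivative d) (at r) \<and> - K * pradr r \<le> d"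
    if "a < r" "r < R" for r
  proof -
    have r: "0 < r" "r < R" "g r < G" "E r < e" "c / 2 < H r" using a(2)[OF that] by auto
    have xy: "x r > 0" "y r > 0" using xy_pos r by auto
    have P: "pradr r > 0" and rh: "\<rho>r r > 0" using pradr_pos r rhat_pos[OF xy] by auto
    have "c / 2 * w r \<le> pradr r" using r w_pos[OF r(1,2)] by (simp add: prad_eq)
    then have "2 * e / c * (c / 2 * w r) \<le> 2 * e / c * pradr r"
      using e c by (intro mult_left_mono) auto
    moreover have "\<rho>r r \<le> e * w r"
      using r w_pos[OF r(1,2)] by (simp add: \<rho>_eq mult.commute)
    ultimately have "pradr r + \<rho>r r \<le> (1 + 2 * e / c) * pradr r" using c by (simp add: algebra_simps)
    moreover have g: "g r \<ge> 0" using r P m_bounds[of r] by (simp add: g_def)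
    ultimately have "(pradr r + \<rho>r r) * g r \<le> (1 + 2 * e / c) * pradr r * G"
      using r P rh e c by (intro mult_mono) auto
    then have "- K * pradr r \<le> - (pradr r + \<rho>r r) * g r" by (simp add: K_def algebra_simps)
    \<comment> \<open>By \<open>x_less_y\<close> the anisotropy term is nonnegative, so dropping it
      preserves a lower bound on the derivative.\<close>
    moreover have "2 / r * (ptanr r - pradr r) \<ge> 0"
      unfolding pthat_minus_prhat[OF xy] using r k x_less_y[of r] w_pos[of r]
      by (intro mult_nonneg_nonneg) (auto simp: w_def)
    ultimately show ?thesis using pradr_deriv[OF r(1,2)] unfolding g_def by force
  qed
  \<comment> \<open>Gronwall argument with integrating factor \<open>exp (K * r)\<close>: a positive
    value at \<open>s\<close> stays below the limit at \<open>R\<close>, which is 0.\<close>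
  have mono: "pradr s * exp (K * s) \<le> pradr r * exp (K * r)" if r: "s \<le> r" "r < R" for r
  proof (rule DERIV_nonneg_imp_nondecreasing[OF r(1)])
    fix t assume "s \<le> t" "t \<le> r"
    then obtain d where d: "(pradr has_real_derivative d) (at t)" "- K * pradr t \<le> d"
      using lower[of t] s r by auto
    have "((\<lambda>t. pradr t * exp (K * t)) has_real_derivative (d + K * pradr t) * exp (K * t)) (at t)"
      by (rule derivative_eq_intros d(1) refl)+ (simp add: algebra_simps)
    moreover have "(d + K * pradr t) * exp (K * t) \<ge> 0" using d(2) by simp
    ultimately show "\<exists>d. ((\<lambda>t. pradr t * exp (K * t)) has_real_derivative d) (at t) \<and> 0 \<le> d"
      by blast
  qed
  have "pradr s * exp (K * s) \<le> 0"
  proof (rule tendsto_lowerbound)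
    show "((\<lambda>r. pradr r * exp (K * r)) \<longlongrightarrow> 0) (at_left R)"
      by (rule tendsto_eq_intros prad_lim refl)+ simp
    show "\<forall>\<^sub>F r in at_left R. pradr s * exp (K * s) \<le> pradr r * exp (K * r)"
      using s mono by (intro eventually_at_leftI[of s]) auto
  qed simp
  moreover have "pradr s > 0" using a(2)[OF s] pradr_pos by simp
  ultimately show False by (simp add: mult_le_0_iff)
qed

section \<open>The energy conditions\<close>

lemma radial_bounds:
  assumes "0 < r" "r < R"
  shows "0 < pradr r / \<rho>r r" "pradr r / \<rho>r r < p0 (nr r) / \<rho>0 (nr r)"
proof -
  have xy: "x r > 0" "y r > 0" using xy_pos assms by auto
  show "0 < pradr r / \<rho>r r" using pradr_pos assms rhat_pos[OF xy] by simp
  show "pradr r / \<rho>r r < p0 (nr r) / \<rho>0 (nr r)"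
    using prhat_less[OF xy x_less_y[OF assms]] rhat_pos[OF xy] by (simp add: divide_less_eq)
qed

lemma x_le_y_closed: "0 \<le> r \<Longrightarrow> r \<le> R \<Longrightarrow> x r \<le> y r"
  using x_le_y[of r] x_R_le_y_R by (cases "r = R") auto

text \<open>Only at \<open>R\<close> can \<open>x\<close> vanish. There density and tangential
  pressure are 0 by convention, and the energy conditions reduce to
  \<open>0 \<le> 0\<close>.\<close>

lemma xy_cases:
  assumes "0 \<le> r" "r \<le> R"
  obtains "x r > 0" "y r > 0" | "r = R" "\<rho>r r = 0" "ptanr r = 0"
proof (cases "x r > 0")
  case True
  then show ?thesis using that(1) x_le_y_closed[OF assms] by simp
next
  case False
  then have "r = R" using xy_pos(1)[of r] assms by force
  moreover from this have "x r = 0" using False x_R_nonneg by simp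
  ultimately show ?thesis using that(2) by (simp add: john_rho_def john_ptan_def)
qed

lemma dominant_energy_radial: "dominant_energy pradr \<rho>r R"
  unfolding dominant_energy_def
proof
  fix r assume "r \<in> {0..R}"
  then have r: "0 \<le> r" "r \<le> R" by auto
  have "pradr r \<ge> 0" using pradr_pos[of r] pradr_R r by (cases "r = R") auto
  moreover from r have "pradr r \<le> \<rho>r r"
    by (cases rule: xy_cases) (use pradr_R r x_le_y_closed in \<open>auto intro: prhat_le_rhat\<close>)
  ultimately show "\<bar>pradr r\<bar> \<le> \<rho>r r" by simp
qed

lemma tangential_bounds:
  assumes "0 < r" "r < R" "\<beta> = max k (1/3)"
  shows "0 < ptanr r / \<rho>r r" "ptanr r / \<rho>r r < p0 (nr r) / \<rho>0 (nr r) + \<beta>"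
proof -
  have xy: "x r > 0" "y r > 0" using xy_pos assms by auto
  have le: "x r \<le> y r" using x_less_y assms by fastforce
  show "0 < ptanr r / \<rho>r r" using pthat_bounds(1)[OF xy le assms(3)] rhat_pos[OF xy] by simp
  show "ptanr r / \<rho>r r < p0 (nr r) / \<rho>0 (nr r) + \<beta>"
    using pthat_bounds(2)[OF xy le assms(3)] rhat_pos[OF xy] by (simp add: divide_less_eq)
qed

lemma dominant_energy_tangential:
  assumes "\<beta> = max k (1/3)" "\<And>n. n \<ge> 0 \<Longrightarrow> p0 n \<le> (1 - \<beta>) * \<rho>0 n"
  shows "dominant_energy ptanr \<rho>r R"
  unfolding dominant_energy_def
proof
  fix r assume "r \<in> {0..R}"
  then have r: "0 \<le> r" "r \<le> R" by auto
  from r show "\<bar>ptanr r\<bar> \<le> \<rho>r r"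
  proof (cases rule: xy_cases)
    case 1
    have n: "nr r > 0" using particle_density_pos[OF 1] .
    have "p0 (nr r) / \<rho>0 (nr r) + \<beta> \<le> 1"
      using assms(2)[of "nr r"] \<rho>0_pos[OF n] n by (simp add: field_simps)
    then have "(p0 (nr r) / \<rho>0 (nr r) + \<beta>) * \<rho>r r \<le> 1 * \<rho>r r"
      using rhat_pos[OF 1] by (intro mult_right_mono) auto
    then show ?thesis using pthat_bounds[OF 1 x_le_y_closed[OF r] assms(1)] by simp
  qed simp
qed

lemma tangential_violation:
  assumes lim: "((\<lambda>r. 3 * p0 (nr r) / (2 * \<rho>0 (nr r))) \<longlongrightarrow> L) (at_left R)" and L: "L > 1"
  shows "\<exists>\<epsilon>>0. \<forall>r\<in>{R-\<epsilon><..R}. ptanr r > \<rho>r r"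
proof -
  have xR: "x R > 0" by (rule x_R_pos[OF assms])
  have n: "nr R > 0" using particle_density_pos xR y_R_pos by simp
  have pos: "x r > 0 \<and> y r > 0" if "r \<in> {0..R}" for r
    using that xR y_R_pos xy_pos[of r] by (cases "r = R") auto
  note cont = continuous_on_hats[OF continuous_on_xym(1,2) pos]
  \<comment> \<open>Since \<open>x R > 0\<close>, the quotient is continuous up to \<open>R\<close>,
    so \<open>L\<close> is its value there and p0/\<rho>0 exceeds 2/3 at \<open>R\<close>.\<close>
  have "continuous_on {0..R} (\<lambda>r. 3 * p0 (nr r) / (2 * \<rho>0 (nr r)))"
    using pos \<rho>0_pos particle_density_pos
    by (intro continuous_intros cont) (auto simp: less_imp_neq[symmetric])
  from continuous_on_Icc_at_leftD[OF this R_pos] tendsto_unique[OF _ _ lim]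
  have "3 * p0 (nr R) / (2 * \<rho>0 (nr R)) = L" by simp
  then have w: "p0 (nr R) / \<rho>0 (nr R) > 2 / 3"
    using L \<rho>0_pos[OF n] by (simp add: field_simps)
  \<comment> \<open>Vanishing radial pressure says that its shear term equals \<open>T\<close>, the
    ratio p0/\<rho>0 times the density. The tangential shear term is half as large and of opposite
    sign, which yields \<open>3/2 * T\<close>.\<close>
  have aux: "T + W * (2 * k * d / 3) = T + T / 2" if "T - W * (4 * k * d / 3) = 0" for T W d
    using that by (simp add: field_simps)
  have "ptanr R = p0 (nr R) / \<rho>0 (nr R) * \<rho>r R + (p0 (nr R) / \<rho>0 (nr R) * \<rho>r R) / 2"
    unfolding pthat_eq[OF xR y_R_pos]
    by (rule aux) (use prhat_eq[OF xR y_R_pos] pradr_R in linarith)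
  moreover have "p0 (nr R) / \<rho>0 (nr R) * \<rho>r R > 2 / 3 * \<rho>r R"
    using w rhat_pos[OF xR y_R_pos] by (intro mult_strict_right_mono)
  moreover have "\<rho>r R < Z + Z / 2" if "Z > 2 / 3 * \<rho>r R" for Z
    using that by simp
  ultimately have R: "ptanr R > \<rho>r R" by presburger
  have "((\<lambda>r. ptanr r - \<rho>r r) \<longlongrightarrow> ptanr R - \<rho>r R) (at_left R)"
    using R_pos by (intro continuous_on_Icc_at_leftD[of 0 R] continuous_on_diff cont)
  then have "\<forall>\<^sub>F r in at_left R. ptanr r - \<rho>r r > 0"
    by (rule order_tendstoD(1)) (use R in simp)
  then obtain a where a: "a < R" "\<And>r. a < r \<Longrightarrow> r < R \<Longrightarrow> ptanr r > \<rho>r r"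
    using eventually_at_left[of "R - 1" R] by auto
  have "ptanr r > \<rho>r r" if "r \<in> {R - (R - a)<..R}" for r
    using that a(2)[of r] R by (cases "r = R") auto
  with a(1) show ?thesis by (intro exI[of _ "R - a"]) simp
qed

end

theorem proposition2:
  fixes k R M :: real and \<rho>0 p0 x y m \<rho> prad ptan \<rho>0r p0r :: "real \<Rightarrow> real"
  assumes k: "k > 0"
    and p0: "p0 = fluid_pressure \<rho>0"
    and F1: "fluid_F1 \<rho>0"
    and F2: "fluid_F2 p0"
    and F3: "fluid_F3 \<rho>0 p0"
    and ball: "regular_ball k \<rho>0 R M x y m"
    and \<rho>: "\<rho> = (\<lambda>r. john_rho k \<rho>0 (x r) (y r))"
    and prad: "prad = (\<lambda>r. john_prad k \<rho>0 (x r) (y r))"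
    and ptan: "ptan = (\<lambda>r. john_ptan k \<rho>0 (x r) (y r))"
    and \<rho>0r: "\<rho>0r = (\<lambda>r. \<rho>0 (particle_density (x r) (y r)))"
    and p0r: "p0r = (\<lambda>r. p0 (particle_density (x r) (y r)))"
  shows "(dominant_energy prad \<rho> R \<and>
          (\<forall>r\<in>{0<..<R}. 0 < prad r / \<rho> r \<and> prad r / \<rho> r < p0r r / \<rho>0r r)) \<and>
         (\<forall>\<beta>. k < 1 \<longrightarrow> \<beta> = max k (1/3) \<longrightarrow> (\<forall>n\<ge>0. p0 n \<le> (1 - \<beta>) * \<rho>0 n) \<longrightarrow>
            dominant_energy ptan \<rho> R \<and>
            (\<forall>r\<in>{0<..<R}. 0 < ptan r / \<rho> r \<and> ptan r / \<rho> r < p0r r / \<rho>0r r + \<beta>)) \<and>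
         (\<forall>L. ((\<lambda>r. 3 * p0r r / (2 * \<rho>0r r)) \<longlongrightarrow> L) (at_left R) \<longrightarrow> L > 1 \<longrightarrow>
            (\<exists>\<epsilon>>0. \<forall>r\<in>{R-\<epsilon><..R}. ptan r > \<rho> r))"
proof -
  interpret john_ball k \<rho>0 R M x y m
    using k F1 F2 F3 ball unfolding p0 by unfold_locales
  show ?thesis
    unfolding p0 \<rho> prad ptan \<rho>0r p0r
    using dominant_energy_radial radial_bounds dominant_energy_tangential tangential_bounds
      tangential_violation
    by (intro conjI allI impI ballI) auto
qed

end
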